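(* There is an absolute constant $C$ such that the following holds. If $A = \{a_1 < a_2 < \dots\}$ is an admissible infinite strictly increasing sequence of natural numbers with $a_j \ge \exp(C j/\log j)$ for infinitely many $j$, then $A$ has property $Q$.
   Context: $\mathrm{SF}$ denotes the set of squarefree positive integers. A set $A \subseteq \mathbb{N}$ is admissible if for each prime $p$ there is a residue class $b_p \pmod{p^2}$ containing no element of $A$. $A$ has property $Q$ if there are infinitely many $n \in \mathbb{N}$ such that $n + a \in \mathrm{SF}$ for all $a \in A$ with $a < n$. *)

theory Defs
  imports Complex_Main "HOL-Computational_Algebra.Squarefree" "HOL-Number_Theory.Cong"
begin

definition SF :: "nat set" where
  "SF = {n. 0 < n \<and> squarefree n}"

definition admissible :: "nat set \<Rightarrow> bool" where
  "admissible A \<longleftrightarrow> (\<forall>p. prime p \<longrightarrow> (\<exists>b. \<forall>a\<in>A. \<not> [a = b] (mod p ^ 2)))"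

definition property_Q :: "nat set \<Rightarrow> bool" where
  "property_Q A \<longleftrightarrow> infinite {n. \<forall>a\<in>A. a < n \<longrightarrow> n + a \<in> SF}"

end

theory Submission
  imports Defs "HOL-Library.Infinite_Set"
begin

text \<open>
  For infinitely many \<open>j\<close> we look for \<open>n \<le> a j\<close>, so that only the shifts \<open>a i\<close> with \<open>i < j\<close> matter.
  By admissibility and the Chinese remainder theorem there is a class \<open>r\<close> modulo the product \<open>M\<close> of
  all \<open>p\<^sup>2\<close> with \<open>p \<le> y = 2 ^ m\<close> for which no \<open>n + a i\<close> is divisible by such a \<open>p\<^sup>2\<close>; Chebyshev's
  estimate gives \<open>M \<le> 2 ^ (4 * y)\<close>. Among the \<open>n\<close> in this class, the proportion excluded by the larger
  primes is about \<open>j\<close> times the sum of \<open>1 / p\<^sup>2\<close> over \<open>p > y\<close>. By Chebyshev again this sum is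
  \<open>O(1 / (y log y))\<close>, so \<open>j\<close> may be as large as a small multiple of \<open>y log y\<close>, whereas \<open>n\<close> up to
  \<open>2 ^ (16 * y)\<close> suffices; this is the growth hypothesis. Using powers of \<open>2\<close> as cut-offs keeps
  Chebyshev's estimates to one binomial coefficient bound per dyadic block.
\<close>

section \<open>Chebyshev bounds on dyadic blocks of primes\<close>

definition dyadic_primes :: "nat \<Rightarrow> nat set" where
  "dyadic_primes i = {p. prime p \<and> 2 ^ i < p \<and> p \<le> 2 ^ Suc i}"

lemma finite_dyadic_primes [simp]: "finite (dyadic_primes i)"
  by (rule finite_subset[of _ "{..2 ^ Suc i}"]) (auto simp: dyadic_primes_def)

lemma prod_primes_dvd:
  fixes n :: nat
  assumes "finite S" "\<And>p. p \<in> S \<Longrightarrow> prime p" "\<And>p. p \<in> S \<Longrightarrow> p dvd n"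
  shows "\<Prod>S dvd n"
  using assms
proof (induction S rule: finite_induct)
  case (insert p S)
  have "coprime p (\<Prod>S)"
    using insert by (intro prod_coprime_right primes_coprime) auto
  then show ?case
    using insert by (auto intro: divides_mult)
qed simp

text \<open>With \<open>n = 2 ^ i\<close>, a prime in the block divides \<open>(2n)!\<close> but not
  \<open>n!\<close>, hence divides the central binomial coefficient, which is at most
  \<open>2 ^ (2n)\<close>.\<close>

lemma prod_dyadic_primes_le: "\<Prod>(dyadic_primes i) \<le> 2 ^ (2 ^ Suc i)"
proof -
  let ?n = "2 ^ i :: nat"
  have "p dvd (2 * ?n) choose ?n" if "p \<in> dyadic_primes i" for p
  proof -
    have p: "prime p" "?n < p" "p \<le> 2 * ?n"
      using that by (auto simp: dyadic_primes_def)
    have "p dvd fact ?n * fact (2 * ?n - ?n) * ((2 * ?n) choose ?n)"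
      using p by (subst binomial_fact_lemma) (auto simp: prime_dvd_fact_iff)
    moreover have "\<not> p dvd fact ?n"
      using p by (simp add: prime_dvd_fact_iff)
    ultimately show ?thesis
      using p by (simp add: prime_dvd_mult_iff mult_2)
  qed
  then have "\<Prod>(dyadic_primes i) dvd (2 * ?n) choose ?n"
    by (intro prod_primes_dvd) (auto simp: dyadic_primes_def)
  then have "\<Prod>(dyadic_primes i) \<le> (2 * ?n) choose ?n"
    by (rule dvd_imp_le) simp
  also have "\<dots> \<le> 2 ^ (2 * ?n)"
    by (rule binomial_le_pow2)
  finally show ?thesis
    by simp
qed

text \<open>Each prime in the block exceeds \<open>2 ^ i\<close>; comparing exponents of 2 in the
  product bound limits their number.\<close>

lemma card_dyadic_primes: "i * card (dyadic_primes i) \<le> 2 ^ Suc i"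
proof -
  have "(2::nat) ^ (i * card (dyadic_primes i)) = (\<Prod>p\<in>dyadic_primes i. 2 ^ i)"
    by (simp add: power_mult)
  also have "\<dots> \<le> \<Prod>(dyadic_primes i)"
    by (rule prod_mono) (auto simp: dyadic_primes_def)
  also note prod_dyadic_primes_le
  finally show ?thesis
    by (simp del: power_Suc)
qed

text \<open>Splitting off the top block doubles the exponent at each step of the induction:
  \<open>2 ^ Suc m + 2 ^ Suc m = 2 ^ Suc (Suc m)\<close>.\<close>

lemma primorial_le: "\<Prod>{p::nat. prime p \<and> p \<le> 2 ^ m} \<le> 2 ^ (2 ^ Suc m)"
proof (induction m)
  case 0
  have "{p::nat. prime p \<and> p \<le> 2 ^ 0} = {}"
    by (auto dest: prime_gt_1_nat)
  then show ?case
    by (simp only:) simp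
next
  case (Suc m)
  have split: "{p::nat. prime p \<and> p \<le> 2 ^ Suc m}
      = {p. prime p \<and> p \<le> 2 ^ m} \<union> dyadic_primes m"
    by (auto simp: dyadic_primes_def)
  have "\<Prod>{p::nat. prime p \<and> p \<le> 2 ^ Suc m}
      = \<Prod>{p. prime p \<and> p \<le> 2 ^ m} * \<Prod>(dyadic_primes m)"
    unfolding split
    by (rule prod.union_disjoint) (auto simp: dyadic_primes_def)
  also have "\<dots> \<le> 2 ^ (2 ^ Suc m) * 2 ^ (2 ^ Suc m)"
    by (intro mult_mono Suc.IH prod_dyadic_primes_le) auto
  finally show ?case
    by (simp flip: power_add add: mult_2)
qed

section \<open>The tail of the sum of inverse squares of primes\<close>

text \<open>The denominator has the fixed \<open>m\<close> instead of \<open>i\<close>, so that the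
  bounds for consecutive blocks form a geometric series.\<close>

lemma sum_inverse_square_dyadic_primes:
  assumes "0 < m" "m \<le> i"
  shows "(\<Sum>p\<in>dyadic_primes i. 1 / real p ^ 2) \<le> 2 / (real m * 2 ^ i)"
proof -
  have "(\<Sum>p\<in>dyadic_primes i. 1 / real p ^ 2) \<le> (\<Sum>p\<in>dyadic_primes i. 1 / (2 ^ i) ^ 2)"
  proof (rule sum_mono)
    fix p
    assume "p \<in> dyadic_primes i"
    then have "2 ^ i < p"
      by (simp add: dyadic_primes_def)
    then have "real (2 ^ i) \<le> real p" "0 < p"
      by auto
    then show "1 / real p ^ 2 \<le> 1 / (2 ^ i) ^ 2"
      by (intro divide_left_mono power_mono) auto
  qed
  also have "\<dots> = real (card (dyadic_primes i)) / (2 ^ i) ^ 2"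
    by simp
  also have "\<dots> \<le> 2 / (real m * 2 ^ i)"
  proof -
    have "m * card (dyadic_primes i) \<le> 2 ^ Suc i"
      using mult_le_mono1[OF assms(2)] card_dyadic_primes by (rule order_trans)
    then have "real m * real (card (dyadic_primes i)) \<le> 2 * 2 ^ i"
      by (metis of_nat_le_iff of_nat_mult of_nat_numeral of_nat_power power_Suc)
    then have "real (card (dyadic_primes i)) * (real m * 2 ^ i) \<le> 2 * (2 ^ i) ^ 2"
      by (simp add: power2_eq_square mult_ac)
    then show ?thesis
      using assms by (simp add: divide_simps)
  qed
  finally show ?thesis .
qed

lemma sum_inverse_square_primes:
  assumes "0 < m"
  shows "(\<Sum>p | prime p \<and> 2 ^ m < p \<and> p \<le> 2 ^ (m + d). 1 / real p ^ 2) \<le> 4 / (real m * 2 ^ m)"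
proof -
  \<comment> \<open>The subtracted term lets the induction telescope: the block at
    \<open>i = m + d\<close> adds at most \<open>2 / (m * 2 ^ i)\<close>, the difference of
    \<open>4 / (m * 2 ^ i)\<close> and \<open>4 / (m * 2 ^ (i + 1))\<close>.\<close>
  have "(\<Sum>p | prime p \<and> 2 ^ m < p \<and> p \<le> 2 ^ (m + d). 1 / real p ^ 2)
      \<le> 4 / (real m * 2 ^ m) - 4 / (real m * 2 ^ (m + d))"
  proof (induction d)
    case 0
    have "{p::nat. prime p \<and> 2 ^ m < p \<and> p \<le> 2 ^ (m + 0)} = {}"
      by auto
    then show ?case
      by (simp only:) simp
  next
    case (Suc d)
    have "p \<le> 2 ^ (m + d) \<Longrightarrow> p \<le> 2 ^ Suc (m + d)" for p :: nat
      by simp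
    moreover have "2 ^ (m + d) < p \<Longrightarrow> 2 ^ m < p" for p :: nat
      by (rule le_less_trans[of _ "2 ^ (m + d)"]) (simp_all add: power_increasing)
    ultimately have split: "{p::nat. prime p \<and> 2 ^ m < p \<and> p \<le> 2 ^ (m + Suc d)}
        = {p. prime p \<and> 2 ^ m < p \<and> p \<le> 2 ^ (m + d)} \<union> dyadic_primes (m + d)"
      by (auto simp del: power_Suc simp: dyadic_primes_def)
    have "(\<Sum>p | prime p \<and> 2 ^ m < p \<and> p \<le> 2 ^ (m + Suc d). 1 / real p ^ 2)
        = (\<Sum>p | prime p \<and> 2 ^ m < p \<and> p \<le> 2 ^ (m + d). 1 / real p ^ 2)
          + (\<Sum>p\<in>dyadic_primes (m + d). 1 / real p ^ 2)"
      unfolding split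
      by (rule sum.union_disjoint) (auto simp: dyadic_primes_def)
    also have "\<dots> \<le> 4 / (real m * 2 ^ m) - 4 / (real m * 2 ^ (m + d)) + 2 / (real m * 2 ^ (m + d))"
      using Suc.IH sum_inverse_square_dyadic_primes[OF assms, of "m + d"] by simp
    also have "\<dots> = 4 / (real m * 2 ^ m) - 4 / (real m * 2 ^ (m + Suc d))"
      using assms by (simp add: field_simps)
    finally show ?case .
  qed
  also have "\<dots> \<le> 4 / (real m * 2 ^ m)"
    by simp
  finally show ?thesis .
qed

section \<open>Sieving an arithmetic progression\<close>

text \<open>Since \<open>M\<close> is invertible modulo \<open>q\<close>, all solutions lie in one
  residue class. Cutting the interval into blocks of length \<open>q\<close> from \<open>L\<close>
  on, each block holds at most one, and \<open>T div q + 1\<close> blocks suffice.\<close>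

lemma card_linear_congruence_solutions:
  fixes M q c L T :: nat
  assumes "coprime M q" "0 < q"
  shows "real (card {t \<in> {L..<L + T}. q dvd M * t + c}) \<le> real T / real q + 1"
proof -
  let ?S = "{t \<in> {L..<L + T}. q dvd M * t + c}"
  have cong: "[s = t] (mod q)" if "s \<in> ?S" "t \<in> ?S" for s t
  proof -
    have "[M * s + c = M * t + c] (mod q)"
      using that by (auto simp: cong_def dvd_eq_mod_eq_0)
    then show ?thesis
      using assms by (simp add: cong_add_rcancel_nat cong_mult_lcancel_nat)
  qed
  have "inj_on (\<lambda>t. (t - L) div q) ?S"
  proof (rule inj_onI)
    fix s t
    assume st: "s \<in> ?S" "t \<in> ?S" and div: "(s - L) div q = (t - L) div q"
    have "[(s - L) + L = (t - L) + L] (mod q)"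
      using cong[OF st] st by simp
    then have "(s - L) mod q = (t - L) mod q"
      by (simp only: cong_add_rcancel_nat) (simp add: cong_def)
    with div have "s - L = t - L"
      by (metis div_mult_mod_eq)
    with st show "s = t"
      by auto
  qed
  moreover have "(\<lambda>t. (t - L) div q) ` ?S \<subseteq> {..T div q}"
    by (auto intro!: div_le_mono)
  ultimately have "card ?S \<le> card {..T div q}"
    by (intro card_inj_on_le) auto
  then have "real (card ?S) \<le> real (T div q) + 1"
    by simp
  also have "\<dots> \<le> real T / real q + 1"
    by (simp add: of_nat_div_le_of_nat)
  finally show ?thesis .
qed

lemma admissible_avoiding_progression:
  assumes "admissible A"
  obtains r M :: nat where "0 < M" "r < M" "M \<le> 2 ^ (4 * 2 ^ m)"
    "\<And>p. prime p \<Longrightarrow> 2 ^ m < p \<Longrightarrow> coprime M p"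
    "\<And>p t a. prime p \<Longrightarrow> p \<le> 2 ^ m \<Longrightarrow> a \<in> A \<Longrightarrow> \<not> p ^ 2 dvd r + M * t + a"
proof -
  define P where "P = {p::nat. prime p \<and> p \<le> 2 ^ m}"
  define M where "M = (\<Prod>p\<in>P. p ^ 2)"
  have fin: "finite P"
    by (simp add: P_def)
  have "\<forall>p. \<exists>b. prime p \<longrightarrow> (\<forall>a\<in>A. \<not> [a = b] (mod p ^ 2))"
    using assms unfolding admissible_def by blast
  then obtain b where b: "prime p \<Longrightarrow> a \<in> A \<Longrightarrow> \<not> [a = b p] (mod p ^ 2)" for p a
    by metis
  have nz: "\<forall>p\<in>P. p ^ 2 \<noteq> 0"
    by (auto simp: P_def intro: prime_gt_0_nat)
  then have "0 < M"
    by (auto simp: M_def intro!: prod_pos)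
  \<comment> \<open>The residue is \<open>- b p\<close>, written without negative numbers. Then
    \<open>p ^ 2\<close> dividing \<open>r + M * t + a\<close> forces \<open>a\<close> into the
    class \<open>b p\<close> that \<open>A\<close> avoids.\<close>
  have "\<exists>!r. r < (\<Prod>p\<in>P. p ^ 2) \<and> (\<forall>p\<in>P. [r = p ^ 2 - b p mod p ^ 2] (mod p ^ 2))"
    using fin nz by (rule chinese_remainder_unique_nat) (auto simp: P_def intro: primes_coprime)
  then obtain r where r: "r < M" "\<And>p. p \<in> P \<Longrightarrow> [r = p ^ 2 - b p mod p ^ 2] (mod p ^ 2)"
    unfolding M_def by blast
  have "M = (\<Prod>P) ^ 2"
    by (simp add: M_def prod_power_distrib)
  also have "\<dots> \<le> (2 ^ (2 ^ Suc m)) ^ 2"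
    unfolding P_def by (intro power_mono primorial_le) auto
  also have "\<dots> = 2 ^ (4 * 2 ^ m)"
    by (simp flip: power_mult)
  finally have "M \<le> 2 ^ (4 * 2 ^ m)" .
  moreover have "coprime M p" if "prime p" "2 ^ m < p" for p
    unfolding M_def using that
    by (intro prod_coprime_left) (auto simp: P_def intro!: primes_coprime)
  moreover have "\<not> p ^ 2 dvd r + M * t + a" if "prime p" "p \<le> 2 ^ m" "a \<in> A" for p t a
  proof
    assume dvd: "p ^ 2 dvd r + M * t + a"
    have p: "p \<in> P"
      using that by (simp add: P_def)
    then have "p ^ 2 dvd M"
      unfolding M_def using fin by (intro dvd_prodI)
    moreover have "r + M * t + a = M * t + (r + a)"
      by simp
    ultimately have "p ^ 2 dvd r + a"
      using dvd by (metis dvd_add_right_iff dvd_mult2)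
    moreover have "p ^ 2 dvd r + b p"
    proof -
      have "[r + b p = (p ^ 2 - b p mod p ^ 2) + b p mod p ^ 2] (mod p ^ 2)"
        using r(2)[OF p] by (intro cong_add) (auto simp: cong_def)
      also have "(p ^ 2 - b p mod p ^ 2) + b p mod p ^ 2 = p ^ 2"
        using nz p by (simp add: less_imp_le)
      finally show ?thesis
        by (simp add: cong_def dvd_eq_mod_eq_0)
    qed
    ultimately have "[r + a = r + b p] (mod p ^ 2)"
      by (simp add: cong_def dvd_eq_mod_eq_0)
    then have "[a = b p] (mod p ^ 2)"
      by (simp add: cong_add_lcancel_nat)
    with b that show False
      by blast
  qed
  ultimately show thesis
    using that \<open>0 < M\<close> r(1) by blast
qed

text \<open>A union bound: were every translate to fail, the sets \<open>S b p\<close> would cover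
  the interval of all \<open>t\<close>, yet their sizes add up to at most
  \<open>T / 4 + T / 8\<close>.\<close>

lemma exists_squarefree_translate:
  assumes "0 < m" "finite B" "16 * card B \<le> 2 ^ m * m" "admissible B" "L \<le> 2 ^ m"
  shows "\<exists>n\<ge>L. n \<le> 2 ^ (16 * 2 ^ m) \<and> (\<forall>b\<in>B. b < n \<longrightarrow> n + b \<in> SF)"
proof (rule ccontr)
  assume none: "\<not> ?thesis"
  \<comment> \<open>Work with the translates \<open>r + M * t\<close> for \<open>t\<close> in an interval of length \<open>T\<close>: with this \<open>T\<close> they stay
    below \<open>2 ^ (16 * y)\<close>, while the square root of that bound, which bounds the number of primes to be sieved, is \<open>o(T)\<close>.\<close>
  define y :: nat where "y = 2 ^ m"
  define T :: nat where "T = 2 ^ (11 * y)"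
  have "1 \<le> y"
    by (simp add: y_def)
  obtain r M where M: "0 < M" "r < M" "M \<le> 2 ^ (4 * y)"
    and cop: "\<And>p. prime p \<Longrightarrow> y < p \<Longrightarrow> coprime M p"
    and avoid: "\<And>p t a. prime p \<Longrightarrow> p \<le> y \<Longrightarrow> a \<in> B \<Longrightarrow> \<not> p ^ 2 dvd r + M * t + a"
    using admissible_avoiding_progression[OF assms(4)] unfolding y_def by metis
  \<comment> \<open>The sieve must reach the square root of \<open>n + b\<close>, where
    \<open>b < n \<le> 2 ^ (16 * y)\<close>; \<open>2 ^ (8 * y + 1)\<close> is enough. As
    \<open>m < y\<close>, the subtraction does not truncate.\<close>
  define d where "d = 8 * y + 1 - m"
  have "m < y"
    unfolding y_def by (rule less_exp)
  then have d: "m + d = 8 * y + 1"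
    by (simp add: d_def)
  define Q where "Q = {p::nat. prime p \<and> 2 ^ m < p \<and> p \<le> 2 ^ (m + d)}"
  have fin: "finite Q"
    by (simp add: Q_def)
  define S where "S b p = {t \<in> {L..<L + T}. p ^ 2 dvd M * t + (r + b)}" for b p
  have cover: "{L..<L + T} \<subseteq> (\<Union>b\<in>B. \<Union>p\<in>Q. S b p)"
  proof
    fix t
    assume t: "t \<in> {L..<L + T}"
    define n where "n = r + M * t"
    \<comment> \<open>Starting the interval at \<open>L\<close> makes \<open>n\<close> at least
      \<open>L\<close>, which is how arbitrarily large \<open>n\<close> arise.\<close>
    have "t \<le> M * t"
      using M by simp
    then have "L \<le> n"
      unfolding n_def using t by (meson atLeastLessThan_iff le_trans trans_le_add2)
    have "n \<le> M * (t + 1)"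
      using M by (simp add: n_def)
    also have "\<dots> \<le> 2 ^ (4 * y) * (2 ^ (12 * y))"
    proof (intro mult_mono)
      have "t + 1 \<le> y + T"
        using t assms(5) by (simp add: y_def)
      also have "y \<le> 2 ^ (11 * y)"
        by (metis le_trans less_exp less_imp_le mult_le_mono1 nat_mult_1 one_le_numeral)
      also have "2 ^ (11 * y) + T = 2 ^ (11 * y + 1)"
        by (simp add: T_def)
      also have "\<dots> \<le> 2 ^ (12 * y)"
        using \<open>1 \<le> y\<close> by (intro power_increasing) auto
      finally show "t + 1 \<le> 2 ^ (12 * y)"
        by simp
    qed (use M in auto)
    also have "\<dots> = 2 ^ (16 * y)"
      by (simp flip: power_add)
    finally have n: "n \<le> 2 ^ (16 * y)" .
    with none \<open>L \<le> n\<close> obtain b where b: "b \<in> B" "b < n" "n + b \<notin> SF"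
      unfolding y_def by blast
    then obtain p where p: "prime p" "p ^ 2 dvd n + b"
      unfolding SF_def using squarefree_factorial_semiring[of "n + b"] by auto
    with avoid b have "y < p"
      unfolding n_def by (meson not_le)
    have "p ^ 2 \<le> n + b"
      using p b by (intro dvd_imp_le) auto
    also have "\<dots> \<le> 2 ^ (16 * y + 2)"
      using n b by simp
    also have "\<dots> = (2 ^ (8 * y + 1)) ^ 2"
      by (simp flip: power_mult)
    finally have "p \<le> 2 ^ (m + d)"
      unfolding d by (simp only: power2_nat_le_eq_le)
    with \<open>y < p\<close> p have "p \<in> Q"
      by (simp add: Q_def y_def)
    moreover have "t \<in> S b p"
      using p t by (simp add: S_def n_def add_ac)
    ultimately show "t \<in> (\<Union>b\<in>B. \<Union>p\<in>Q. S b p)"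
      using b by blast
  qed
  have "real (card (S b p)) \<le> real T / real p ^ 2 + 1" if "p \<in> Q" for b p
  proof -
    have "coprime M (p ^ 2)" "0 < p ^ 2"
      using that cop by (auto simp: Q_def y_def prime_gt_0_nat)
    then show ?thesis
      unfolding S_def using card_linear_congruence_solutions[of M "p ^ 2" L T] by simp
  qed
  then have "(\<Sum>p\<in>Q. real (card (S b p))) \<le> (\<Sum>p\<in>Q. real T * (1 / real p ^ 2) + 1)" for b
    by (intro sum_mono) auto
  \<comment> \<open>The main terms are bounded by the tail sum over primes, and the rounding errors
    \<open>1\<close> by the number of integers up to the sieve limit.\<close>
  moreover have "(\<Sum>p\<in>Q. real T * (1 / real p ^ 2) + 1) \<le> real T * (4 / (real m * 2 ^ m)) + 2 ^ (8 * y + 1)"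
  proof -
    have "card Q \<le> card {1..(2::nat) ^ (m + d)}"
      by (rule card_mono) (auto simp: Q_def)
    then have "real (card Q) \<le> real (2 ^ (8 * y + 1))"
      unfolding d by (subst of_nat_le_iff) simp
    moreover have "real T * (\<Sum>p\<in>Q. 1 / real p ^ 2) \<le> real T * (4 / (real m * 2 ^ m))"
      unfolding Q_def by (intro mult_left_mono sum_inverse_square_primes assms(1)) simp
    ultimately show ?thesis
      unfolding sum.distrib sum_distrib_left[symmetric] by simp
  qed
  ultimately have inner: "(\<Sum>p\<in>Q. real (card (S b p)))
      \<le> real T * (4 / (real m * 2 ^ m)) + 2 ^ (8 * y + 1)" for b
    using order_trans by blast
  have "T = card {L..<L + T}"
    by simp
  also have "\<dots> \<le> card (\<Union>b\<in>B. \<Union>p\<in>Q. S b p)"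
    using assms(2) fin cover by (intro card_mono) (auto simp: S_def)
  also have "\<dots> \<le> (\<Sum>b\<in>B. card (\<Union>p\<in>Q. S b p))"
    by (rule card_UN_le[OF assms(2)])
  also have "\<dots> \<le> (\<Sum>b\<in>B. \<Sum>p\<in>Q. card (S b p))"
    by (intro sum_mono card_UN_le fin)
  finally have "real T \<le> (\<Sum>b\<in>B. \<Sum>p\<in>Q. real (card (S b p)))"
    by (simp flip: of_nat_sum)
  also have "\<dots> \<le> (\<Sum>b\<in>B. real T * (4 / (real m * 2 ^ m)) + 2 ^ (8 * y + 1))"
    by (intro sum_mono inner)
  also have "\<dots> = real (card B) * (real T * (4 / (real m * 2 ^ m)) + 2 ^ (8 * y + 1))"
    by simp
  \<comment> \<open>The bound on \<open>card B\<close> cancels the denominator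
    \<open>m * 2 ^ m\<close>; the factor 16 against the 4 leaves \<open>T / 4\<close>.\<close>
  also have "\<dots> \<le> (2 ^ m * real m / 16) * (real T * (4 / (real m * 2 ^ m)) + 2 ^ (8 * y + 1))"
  proof (rule mult_right_mono)
    have "real (16 * card B) \<le> real (2 ^ m * m)"
      using assms(3) by (subst of_nat_le_iff)
    then show "real (card B) \<le> 2 ^ m * real m / 16"
      by simp
  qed simp
  also have "\<dots> = real T / 4 + real y * real m * 2 ^ (8 * y) / 8"
    using assms(1) by (simp add: y_def field_simps)
  \<comment> \<open>Both \<open>y\<close> and \<open>m\<close> are below \<open>2 ^ y\<close>, so
    the error is absorbed by the exponent \<open>11 * y\<close> of \<open>T\<close>.\<close>
  also have "\<dots> \<le> real T / 4 + real T / 8"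
  proof -
    have "y * m * 2 ^ (8 * y) \<le> 2 ^ y * 2 ^ y * 2 ^ (8 * y)"
      using less_trans[OF \<open>m < y\<close> less_exp[of y]] by (intro mult_mono) auto
    also have "\<dots> = 2 ^ (10 * y)"
      by (simp flip: power_add)
    also have "\<dots> \<le> T"
      unfolding T_def by (intro power_increasing) auto
    finally have "real (y * m * 2 ^ (8 * y)) \<le> real T"
      by (subst of_nat_le_iff)
    then show ?thesis
      by simp
  qed
  also have "\<dots> < real T"
    by (simp add: T_def)
  finally show False
    by simp
qed

section \<open>Matching the sieve scale to the growth condition\<close>

text \<open>For the least admissible \<open>m = k + 1\<close>, minimality gives
  \<open>2 ^ k * k \<le> 16 * j\<close>, while \<open>j \<le> 4 ^ k\<close> makes \<open>k\<close>
  at least \<open>ln j / 2\<close>. Hence \<open>2 ^ m\<close> is of order at most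
  \<open>j / ln j\<close>.\<close>

lemma dyadic_scale:
  assumes "2 \<le> j" "L ^ 2 \<le> j"
  obtains m :: nat where "0 < m" "L \<le> 2 ^ m" "16 * j \<le> 2 ^ m * m"
    "2 ^ (16 * 2 ^ m) \<le> exp (1024 * real j / ln (real j))"
proof -
  define m where "m = (LEAST m. 16 * j \<le> 2 ^ m * m)"
  have "16 * j \<le> 2 ^ (16 * j) * (16 * j)"
    by simp
  then have m: "16 * j \<le> 2 ^ m * m"
    unfolding m_def by (rule LeastI)
  have "m \<noteq> 0"
    using m assms by (intro notI) simp
  then obtain k where k: "m = Suc k"
    by (cases m) auto
  have "\<not> 16 * j \<le> 2 ^ k * k"
    using k not_less_Least[of k "\<lambda>m. 16 * j \<le> 2 ^ m * m"] by (simp add: m_def)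
  then have lower: "2 ^ k * k \<le> 16 * j"
    by simp
  have upper: "j \<le> 2 ^ (2 * k)" "16 * j \<le> (2 ^ m) ^ 2"
  proof -
    show "16 * j \<le> (2 ^ m) ^ 2"
      using m mult_left_mono[OF less_imp_le[OF less_exp[of m]], of "2 ^ m"]
      unfolding power2_eq_square by linarith
    also have "(2 ^ m) ^ 2 = 4 * (2::nat) ^ (2 * k)"
      by (simp add: k power_mult_distrib power_mult mult.commute flip: power_mult)
    finally show "j \<le> 2 ^ (2 * k)"
      by simp
  qed
  have "L ^ 2 \<le> (2 ^ m) ^ 2"
    using assms upper by linarith
  then have "L \<le> 2 ^ m"
    by (simp only: power2_nat_le_eq_le)
  moreover have "2 ^ (16 * 2 ^ m) \<le> exp (1024 * real j / ln (real j))"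
  proof -
    have ln2: "ln 2 \<le> (1::real)"
      using ln_le_minus_one[of "2::real"] by simp
    have "real j \<le> 2 ^ (2 * k)"
      using upper by (metis of_nat_le_iff of_nat_numeral of_nat_power)
    then have "ln (real j) \<le> ln (2 ^ (2 * k))"
      using assms by (subst ln_le_cancel_iff) auto
    also have "\<dots> = real (2 * k) * ln 2"
      by (simp add: ln_realpow)
    also have "\<dots> \<le> 2 * real k"
      using ln2 mult_left_mono[of "ln 2" 1 "real (2 * k)"] by simp
    finally have lnj: "ln (real j) \<le> 2 * real k" .
    have "real (2 ^ k * k) \<le> real (16 * j)"
      using lower by (subst of_nat_le_iff)
    then have "2 ^ k * real k \<le> 16 * real j"
      by simp
    moreover have "2 ^ k * ln (real j) \<le> 2 ^ k * (2 * real k)"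
      using lnj by simp
    \<comment> \<open>The constant arises here: \<open>2 ^ k * ln j\<close> is at most twice
      \<open>16 * j\<close>, and the exponent \<open>16 * 2 ^ m\<close> equals
      \<open>32 * 2 ^ k\<close>, so \<open>32 * 32 = 1024\<close>.\<close>
    ultimately have "32 * 2 ^ k * ln (real j) \<le> 1024 * real j"
      by linarith
    moreover have "0 < ln (real j)"
      using assms by simp
    ultimately have "32 * 2 ^ k \<le> 1024 * real j / ln (real j)"
      by (simp add: pos_le_divide_eq)
    moreover have "ln 2 * (32 * 2 ^ k :: real) \<le> 1 * (32 * 2 ^ k)"
      using ln2 by (intro mult_right_mono) auto
    moreover have "real (16 * 2 ^ m) * ln 2 = ln 2 * (32 * 2 ^ k)"
      by (simp add: k)
    ultimately have "real (16 * 2 ^ m) * ln 2 \<le> 1024 * real j / ln (real j)"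
      by linarith
    then have "exp (real (16 * 2 ^ m) * ln 2) \<le> exp (1024 * real j / ln (real j))"
      by (simp only: exp_le_cancel_iff)
    then show ?thesis
      by (simp only: exp_of_nat_mult) simp
  qed
  ultimately show thesis
    using that m \<open>m \<noteq> 0\<close> by blast
qed

section \<open>Passage to the infinite sequence\<close>

lemma admissible_subset: "admissible A \<Longrightarrow> B \<subseteq> A \<Longrightarrow> admissible B"
  unfolding admissible_def by blast

theorem theorem1p5:
  "\<exists>C::real. \<forall>a :: nat \<Rightarrow> nat.
     strict_mono_on {1..} a \<longrightarrow>
     admissible (a ` {1..}) \<longrightarrow>
     infinite {j. j \<ge> 1 \<and> real (a j) \<ge> exp (C * real j / ln (real j))} \<longrightarrow>
     property_Q (a ` {1..})"
proof (intro exI[of _ 1024] allI impI)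
  fix a :: "nat \<Rightarrow> nat"
  assume mono: "strict_mono_on {1..} a" and adm: "admissible (a ` {1..})"
    and inf: "infinite {j. j \<ge> 1 \<and> real (a j) \<ge> exp (1024 * real j / ln (real j))}"
  show "property_Q (a ` {1..})"
    unfolding property_Q_def infinite_nat_iff_unbounded_le
  proof
    fix L :: nat
    \<comment> \<open>Taking \<open>j\<close> beyond \<open>L ^ 2\<close> yields
      \<open>L \<le> 2 ^ m\<close>, and \<open>2 \<le> j\<close> keeps \<open>ln j\<close>
      positive.\<close>
    obtain j where j: "2 + L ^ 2 \<le> j" and aj: "exp (1024 * real j / ln (real j)) \<le> real (a j)"
      using inf unfolding infinite_nat_iff_unbounded_le by blast
    have "2 \<le> j" "L ^ 2 \<le> j"
      using j by auto
    then obtain m where m: "0 < m" "L \<le> 2 ^ m" "16 * j \<le> 2 ^ m * m"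
      and le: "2 ^ (16 * 2 ^ m) \<le> exp (1024 * real j / ln (real j))"
      by (rule dyadic_scale)
    have "real (2 ^ (16 * 2 ^ m)) \<le> real (a j)"
      using order_trans[OF le aj] by simp
    then have N: "2 ^ (16 * 2 ^ m) \<le> a j"
      by (subst (asm) of_nat_le_iff)
    have "card (a ` {1..<j}) \<le> j"
      using card_image_le[of "{1..<j}" a] by simp
    then have "16 * card (a ` {1..<j}) \<le> 2 ^ m * m"
      using m by linarith
    moreover have "admissible (a ` {1..<j})"
      using adm by (rule admissible_subset) auto
    ultimately obtain n where n: "L \<le> n" "n \<le> 2 ^ (16 * 2 ^ m)"
      and SF: "\<forall>b\<in>a ` {1..<j}. b < n \<longrightarrow> n + b \<in> SF"
      using exists_squarefree_translate[of m "a ` {1..<j}" L] m by blast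
    \<comment> \<open>Terms with index at least \<open>j\<close> are at least
      \<open>a j \<ge> n\<close>, so only the finitely many sieved shifts can lie below
      \<open>n\<close>.\<close>
    have "n + a i \<in> SF" if "1 \<le> i" "a i < n" for i
    proof -
      have "a i < a j"
        using that n N by linarith
      moreover have "a j \<le> a i" if "j \<le> i"
        using strict_mono_onD[OF mono, of j i] that \<open>2 \<le> j\<close> by (cases "i = j") auto
      ultimately have "i < j"
        by (meson not_le)
      with that SF show ?thesis
        by auto
    qed
    with n show "\<exists>n\<ge>L. n \<in> {n. \<forall>b\<in>a ` {1..}. b < n \<longrightarrow> n + b \<in> SF}"
      by auto
  qed
qed

end
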